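(* Let $G=(V,E)$ be a connected cactus graph. Then $$W_{p}(G)=\sum_{uv\in E}(d_{G}(u)-1)(d_{G}(v)-1)-3c_{6}(G)-5c_{5}(G)-4c_{4}(G)-3c_{3}(G)-2b_{1}(G)-b_{2}(G),$$ where the sum runs over all edges $uv$ of $G$.
   Context: All graphs are finite, simple and undirected. A cactus graph is a connected graph in which no edge lies in more than one cycle. For a connected graph $G$, $d_G(u,v)$ denotes the distance (length of a shortest path) between vertices $u,v$, and $d_G(u)$ denotes the degree of the vertex $u$. The Wiener polarity index $W_p(G)$ is the number of unordered pairs of vertices $\{u,v\}$ of $G$ with $d_G(u,v)=3$. $c_i(G)$ denotes the number of cycles of length $i$ in $G$. $G_1$ is the graph consisting of a triangle together with one pendant edge attached to one vertex of the triangle (vertices $a,b,c,d$ and edges $ab,bc,ca,cd$); $G_2$ is the graph consisting of a 4-cycle together with one pendant edge attached to one vertex of the cycle (vertices $a,b,c,d,e$ and edges $ab,bc,cd,da,ae$). $b_1(G)$ and $b_2(G)$ denote the number of induced subgraphs of $G$ isomorphic to $G_1$ and to $G_2$, respectively. *)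

theory Defs
  imports Main
begin

text \<open>A graph is a vertex set \<open>V\<close> together with a set \<open>E\<close> of two-element subsets of \<open>V\<close>.\<close>

definition simple_graph :: "'a set \<Rightarrow> 'a set set \<Rightarrow> bool" where
  "simple_graph V E \<longleftrightarrow> finite V \<and> (\<forall>e\<in>E. e \<subseteq> V \<and> card e = 2)"

definition degree :: "'a set set \<Rightarrow> 'a \<Rightarrow> nat" where
  "degree E v = card {u. {v, u} \<in> E}"

text \<open>A path is given by its nonempty list of distinct vertices; its length (number of edges) is
  one less than the length of the list.\<close>

definition path_between :: "'a set \<Rightarrow> 'a set set \<Rightarrow> 'a \<Rightarrow> 'a list \<Rightarrow> 'a \<Rightarrow> bool" where
  "path_between V E u p v \<longleftrightarrow>
     p \<noteq> [] \<and> distinct p \<and> set p \<subseteq> V \<and> hd p = u \<and> last p = v \<and>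
     (\<forall>i. Suc i < length p \<longrightarrow> {p ! i, p ! Suc i} \<in> E)"

definition connected_graph :: "'a set \<Rightarrow> 'a set set \<Rightarrow> bool" where
  "connected_graph V E \<longleftrightarrow> V \<noteq> {} \<and> (\<forall>u\<in>V. \<forall>v\<in>V. \<exists>p. path_between V E u p v)"

text \<open>The distance is meaningful only for vertices joined by a path; otherwise the value is
  unspecified.\<close>

definition graph_dist :: "'a set \<Rightarrow> 'a set set \<Rightarrow> 'a \<Rightarrow> 'a \<Rightarrow> nat" where
  "graph_dist V E u v = (LEAST n. \<exists>p. path_between V E u p v \<and> length p = Suc n)"

text \<open>Cycles are subgraphs, not closed walks: a cycle is identified with its set of edges, so that
  the starting point and the orientation of a vertex list do not matter.\<close>

definition cycle_edges :: "'a list \<Rightarrow> 'a set set" where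
  "cycle_edges vs = {{vs ! i, vs ! (Suc i mod length vs)} | i. i < length vs}"

definition cycles_of_length :: "'a set \<Rightarrow> 'a set set \<Rightarrow> nat \<Rightarrow> 'a set set set" where
  "cycles_of_length V E k =
     {cycle_edges vs | vs. length vs = k \<and> 3 \<le> k \<and> distinct vs \<and> set vs \<subseteq> V \<and> cycle_edges vs \<subseteq> E}"

definition cycles :: "'a set \<Rightarrow> 'a set set \<Rightarrow> 'a set set set" where
  "cycles V E = (\<Union>k. cycles_of_length V E k)"

definition cycle_count :: "nat \<Rightarrow> 'a set \<Rightarrow> 'a set set \<Rightarrow> nat" where
  "cycle_count k V E = card (cycles_of_length V E k)"

definition cactus :: "'a set \<Rightarrow> 'a set set \<Rightarrow> bool" where
  "cactus V E \<longleftrightarrow> connected_graph V E \<and>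
     (\<forall>e\<in>E. \<forall>C\<in>cycles V E. \<forall>C'\<in>cycles V E. e \<in> C \<and> e \<in> C' \<longrightarrow> C = C')"

definition wiener_polarity :: "'a set \<Rightarrow> 'a set set \<Rightarrow> nat" where
  "wiener_polarity V E = card {{u, v} | u v. u \<in> V \<and> v \<in> V \<and> u \<noteq> v \<and> graph_dist V E u v = 3}"

definition induced_edges :: "'a set set \<Rightarrow> 'a set \<Rightarrow> 'a set set" where
  "induced_edges E S = {e \<in> E. e \<subseteq> S}"

definition graph_iso :: "'a set \<Rightarrow> 'a set set \<Rightarrow> 'b set \<Rightarrow> 'b set set \<Rightarrow> bool" where
  "graph_iso V E W F \<longleftrightarrow>
     (\<exists>f. bij_betw f V W \<and> (\<forall>u\<in>V. \<forall>v\<in>V. {u, v} \<in> E \<longleftrightarrow> {f u, f v} \<in> F))"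

text \<open>Induced subgraphs are counted by their vertex sets, which determine them.\<close>

definition induced_count :: "'b set \<Rightarrow> 'b set set \<Rightarrow> 'a set \<Rightarrow> 'a set set \<Rightarrow> nat" where
  "induced_count W F V E = card {S. S \<subseteq> V \<and> graph_iso S (induced_edges E S) W F}"

text \<open>The vertices \<open>a, b, c, d, e\<close> are represented by \<open>0, 1, 2, 3, 4\<close>.\<close>

definition G1_vertices :: "nat set" where
  "G1_vertices = {0, 1, 2, 3}"

definition G1_edges :: "nat set set" where
  "G1_edges = {{0, 1}, {1, 2}, {2, 0}, {2, 3}}"

definition G2_vertices :: "nat set" where
  "G2_vertices = {0, 1, 2, 3, 4}"

definition G2_edges :: "nat set set" where
  "G2_edges = {{0, 1}, {1, 2}, {2, 3}, {3, 0}, {0, 4}}"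

definition b1 :: "'a set \<Rightarrow> 'a set set \<Rightarrow> nat" where
  "b1 V E = induced_count G1_vertices G1_edges V E"

definition b2 :: "'a set \<Rightarrow> 'a set set \<Rightarrow> nat" where
  "b2 V E = induced_count G2_vertices G2_edges V E"

end

theory Submission
  imports Defs
begin

text \<open>
  Twice the edge sum counts the ordered trails \<open>a, u, v, b\<close> with three edges, the edge \<open>uv\<close> being
  the middle one. They are classified by the distance between \<open>a\<close> and \<open>b\<close>. Distance 0 gives the
  ordered triangles, distance 1 the ordered 4-cycles. At distance 2 a common neighbour of \<open>a\<close> and
  \<open>b\<close> either lies off the trail, which yields a 5-cycle, or equals \<open>u\<close> or \<open>v\<close>, which yields a
  triangle with a pendant edge, traversed from either end. At distance 3 the trails map onto the
  ordered pairs counted by the Wiener polarity index, and this map is at most two-to-one: the two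
  trails of a pair with two geodesics either form a 6-cycle or share an edge and then form a
  4-cycle with a pendant edge. All coincidences excluded in this classification would produce two
  different cycles with a common edge. A \<open>k\<close>-cycle has \<open>2k\<close> vertex orderings, and both \<open>G\<^sub>1\<close> and
  \<open>G\<^sub>2\<close> have two automorphisms.
\<close>

subsection \<open>Counting lemmas\<close>

text \<open>A dart is an edge with a direction. Each two-element set has exactly two directions, and
  the summand depends on the underlying set only, so every edge contributes twice.\<close>

lemma sum_darts:
  fixes g :: "'a set \<Rightarrow> 'b :: comm_semiring_1"
  assumes "finite C" and two: "\<And>e. e \<in> C \<Longrightarrow> card e = 2"
  shows "(\<Sum>(x, y) \<in> {(x, y). {x, y} \<in> C}. g {x, y}) = 2 * sum g C"
proof -
  let ?D = "{(x, y). {x, y} \<in> C}" and ?h = "\<lambda>(x, y). {x, y}"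
  have "finite (\<Union>C)"
    using assms by (metis card.infinite finite_Union zero_neq_numeral)
  moreover have "?D \<subseteq> \<Union>C \<times> \<Union>C" by auto
  ultimately have fin: "finite ?D"
    by (meson finite_SigmaI finite_subset)
  have fib: "{d \<in> ?D. ?h d = {x, y}} = {(x, y), (y, x)}" if "{x, y} \<in> C" for x y
  proof -
    from that have "{y, x} \<in> C" by (metis insert_commute)
    moreover have "?h d = {x, y} \<longleftrightarrow> d = (x, y) \<or> d = (y, x)" for d
      by (cases d) (simp add: doubleton_eq_iff)
    ultimately show ?thesis using that by auto
  qed
  have img: "?h ` ?D = C"
    using two by (force simp: card_2_iff image_iff)
  have "(\<Sum>d\<in>{d \<in> ?D. ?h d = e}. g (?h d)) = 2 * g e" if "e \<in> C" for e
  proof -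
    from two[OF that] obtain x y where "e = {x, y}" "x \<noteq> y"
      by (auto simp: card_2_iff)
    with fib[of x y] that show ?thesis by (simp add: mult_2 insert_commute)
  qed
  then have "(\<Sum>d\<in>?D. g (?h d)) = (\<Sum>e\<in>C. 2 * g e)"
    using sum.image_gen[OF fin, of "\<lambda>d. g (?h d)" ?h] by (simp add: img)
  then show ?thesis by (simp add: sum_distrib_left case_prod_unfold)
qed

lemma card_darts:
  assumes "finite C" "\<And>e. e \<in> C \<Longrightarrow> card e = 2"
  shows "card {(x, y). {x, y} \<in> C} = 2 * card C"
  using sum_darts[OF assms, of "\<lambda>_. 1 :: nat"] by (simp add: case_prod_unfold)

lemma card_eq_mult_card_image:
  assumes "finite A" "\<And>x. x \<in> A \<Longrightarrow> card {y \<in> A. f y = f x} = c"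
  shows "card A = c * card (f ` A)"
proof -
  have "(\<Sum>z\<in>f ` A. card {y \<in> A. f y = z}) = (\<Sum>z\<in>f ` A. c)"
    using assms(2) by (intro sum.cong) auto
  then show ?thesis
    using sum.image_gen[OF assms(1), of "\<lambda>_. 1 :: nat" f] by simp
qed

text \<open>Fibrewise, twice the size of a fibre is 2 plus the number of its points that have a
  partner: 2 = 2 + 0 for a single point, 4 = 2 + 2 for a pair. Summing over the image gives the
  claim.\<close>

lemma card_at_most_two_to_one:
  assumes "finite A"
    and no3: "\<And>x y z. \<lbrakk>x \<in> A; y \<in> A; z \<in> A; f x = f y; f x = f z\<rbrakk> \<Longrightarrow> x = y \<or> x = z \<or> y = z"
  shows "2 * card A = 2 * card (f ` A) + card {x \<in> A. \<exists>y\<in>A. y \<noteq> x \<and> f y = f x}"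
    (is "_ = _ + card ?T")
proof -
  let ?F = "\<lambda>B z. {y \<in> B. f y = z}"
  have fiber: "2 * card (?F A z) = 2 + card (?F ?T z)" if z: "z \<in> f ` A" for z
  proof -
    from z obtain x where x: "x \<in> A" "f x = z" by auto
    show ?thesis
    proof (cases "x \<in> ?T")
      case True
      then obtain y where y: "y \<in> A" "y \<noteq> x" "f y = f x" by auto
      have "w = x \<or> w = y" if "w \<in> A" "f w = z" for w
        using x y that no3[OF x(1) y(1)] by metis
      then have "?F A z = {x, y}"
        using x y by auto
      moreover have "?F ?T z = ?F A z"
        using x y by auto metis
      ultimately have "?F A z = {x, y}" "?F ?T z = {x, y}" by simp_all
      then show ?thesis using y(2) by simp
    next
      case False
      have only: "w = x" if "w \<in> A" "f w = z" for w
        using x False that by blast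
      have "?F A z = {x}"
        using x only by blast
      moreover have "?F ?T z = {}"
        using False only by blast
      ultimately have "?F A z = {x}" "?F ?T z = {}" .
      then show ?thesis by (simp only: card.empty) simp
    qed
  qed
  have "finite ?T" using assms(1) by simp
  moreover have "f ` ?T \<subseteq> f ` A" by auto
  ultimately have "card ?T = (\<Sum>z\<in>f ` A. card (?F ?T z))"
    using sum.group[of ?T "f ` A" f "\<lambda>_. 1 :: nat"] assms(1) by simp
  moreover have "card A = (\<Sum>z\<in>f ` A. card (?F A z))"
    using sum.image_gen[OF assms(1), of "\<lambda>_. 1 :: nat" f] by simp
  moreover have "(\<Sum>z\<in>f ` A. 2 * card (?F A z)) = (\<Sum>z\<in>f ` A. 2 + card (?F ?T z))"
    by (rule sum.cong[OF refl fiber])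
  ultimately show ?thesis
    by (simp only: sum_distrib_left sum.distrib) simp
qed

subsection \<open>Cycles as vertex lists\<close>

text \<open>Pairing a list with its rotation replaces the index arithmetic modulo the length, so
  that the edges of an explicit list can be computed by simplification.\<close>

lemma cycle_edges_zip: "cycle_edges vs = set (map2 (\<lambda>x y. {x, y}) vs (rotate1 vs))"
proof -
  have "cycle_edges vs = (\<lambda>i. {vs ! i, vs ! (Suc i mod length vs)}) ` {..<length vs}"
    by (auto simp: cycle_edges_def)
  also have "\<dots> = (\<lambda>i. map2 (\<lambda>x y. {x, y}) vs (rotate1 vs) ! i) ` {..<length vs}"
    by (intro image_cong) (simp_all add: nth_rotate1)
  also have "\<dots> = set (map2 (\<lambda>x y. {x, y}) vs (rotate1 vs))"
    by (simp only: set_conv_nth image_def Bex_def length_map length_zip length_rotate1 min.idem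
        lessThan_iff conj_commute)
  finally show ?thesis .
qed

lemma cycle_edges_rotate1: "cycle_edges (rotate1 vs) = cycle_edges vs"
proof -
  have "map2 (\<lambda>x y. {x, y}) (rotate1 vs) (rotate1 (rotate1 vs)) =
      rotate1 (map2 (\<lambda>x y. {x, y}) vs (rotate1 vs))"
  proof (rule nth_equalityI)
    fix i assume "i < length (map2 (\<lambda>x y. {x, y}) (rotate1 vs) (rotate1 (rotate1 vs)))"
    then have "i < length vs" by simp
    moreover from this have "Suc i mod length vs < length vs"
      by (intro mod_less_divisor) linarith
    ultimately show "map2 (\<lambda>x y. {x, y}) (rotate1 vs) (rotate1 (rotate1 vs)) ! i =
        rotate1 (map2 (\<lambda>x y. {x, y}) vs (rotate1 vs)) ! i"
      by (simp add: nth_rotate1)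
  qed simp
  then show ?thesis by (simp add: cycle_edges_zip)
qed

lemma cycle_edges_rotate: "cycle_edges (rotate n vs) = cycle_edges vs"
  by (induction n) (simp_all add: cycle_edges_rotate1)

text \<open>One inclusion suffices, since reversal is an involution. The wrap-around edge is kept
  and the others are met in the opposite order.\<close>

lemma cycle_edges_rev: "cycle_edges (rev vs) = cycle_edges vs"
proof -
  have sub: "cycle_edges (rev xs) \<subseteq> cycle_edges xs" for xs :: "'a list"
  proof
    fix e assume "e \<in> cycle_edges (rev xs)"
    then obtain i where i: "i < length xs" and e: "e = {rev xs ! i, rev xs ! (Suc i mod length xs)}"
      by (auto simp: cycle_edges_def)
    show "e \<in> cycle_edges xs"
    proof (cases "Suc i = length xs")
      case True
      then have "e = {xs ! i, xs ! (Suc i mod length xs)}"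
        using e i by (auto simp: rev_nth insert_commute simp flip: True)
      then show ?thesis using i by (auto simp: cycle_edges_def)
    next
      case False
      \<comment> \<open>Positions \<open>i\<close> and \<open>Suc i\<close> of the reversed list are
        positions \<open>Suc j\<close> and \<open>j\<close> of \<open>xs\<close>.\<close>
      define j where "j = length xs - 2 - i"
      have "e = {xs ! j, xs ! (Suc j mod length xs)}" "j < length xs"
      proof -
        have j: "Suc j < length xs" "rev xs ! i = xs ! Suc j" "rev xs ! Suc i = xs ! j"
          using False i by (auto simp: rev_nth j_def intro: arg_cong[where f = "(!) xs"])
        then show "j < length xs" "e = {xs ! j, xs ! (Suc j mod length xs)}"
          using False i e by (simp_all add: insert_commute)
      qed
      then show ?thesis by (auto simp: cycle_edges_def)
    qed
  qed
  show ?thesis using sub[of vs] sub[of "rev vs"] by simp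
qed

lemma Union_cycle_edges: "\<Union>(cycle_edges vs) = set vs"
proof
  show "\<Union>(cycle_edges vs) \<subseteq> set vs"
    by (auto simp: cycle_edges_zip dest: set_zip_leftD set_zip_rightD)
  show "set vs \<subseteq> \<Union>(cycle_edges vs)"
  proof
    fix x assume "x \<in> set vs"
    then obtain i where i: "i < length vs" "x = vs ! i" by (metis in_set_conv_nth)
    then have "{vs ! i, vs ! (Suc i mod length vs)} \<in> cycle_edges vs"
      unfolding cycle_edges_def by blast
    then show "x \<in> \<Union>(cycle_edges vs)" using i by blast
  qed
qed

text \<open>The map from indices to edges is injective from length 3 on; with two vertices both
  indices would give the same edge.\<close>

lemma card_cycle_edges:
  assumes "distinct vs" "3 \<le> length vs"
  shows "card (cycle_edges vs) = length vs"
proof -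
  have "inj_on (\<lambda>i. {vs ! i, vs ! (Suc i mod length vs)}) {..<length vs}"
    using assms by (cases "vs = []")
      (auto simp: inj_on_def doubleton_eq_iff nth_eq_iff_index_eq mod_Suc split: if_splits)
  moreover have "cycle_edges vs = (\<lambda>i. {vs ! i, vs ! (Suc i mod length vs)}) ` {..<length vs}"
    by (auto simp: cycle_edges_def)
  ultimately show ?thesis by (simp add: card_image)
qed

lemma card_in_cycle_edges:
  assumes "distinct vs" "3 \<le> length vs" "e \<in> cycle_edges vs"
  shows "card e = 2"
proof -
  from assms obtain i where i: "i < length vs" and e: "e = {vs ! i, vs ! (Suc i mod length vs)}"
    by (auto simp: cycle_edges_def)
  then have "vs ! i \<noteq> vs ! (Suc i mod length vs)"
    using assms by (subst nth_eq_iff_index_eq) (auto simp: mod_Suc)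
  then show ?thesis by (simp add: e)
qed

text \<open>The first two vertices fix starting point and direction. From there the list is forced,
  because every vertex of a cycle has only two neighbours along it and one of them has just been
  visited.\<close>

lemma cycle_determined:
  assumes d: "distinct vs" "distinct ws" and l: "2 \<le> length vs" "2 \<le> length ws"
    and C: "cycle_edges vs = cycle_edges ws"
    and st: "vs ! 0 = ws ! 0" "vs ! 1 = ws ! 1"
  shows "vs = ws"
proof (rule nth_equalityI)
  have "set vs = set ws"
    using C by (metis Union_cycle_edges)
  then show len: "length vs = length ws"
    using d by (metis distinct_card)
  have "i < length vs \<Longrightarrow> vs ! i = ws ! i" for i
  proof (induction i rule: less_induct)
    case (less i)
    consider "i = 0" | "i = 1" | j where "i = Suc (Suc j)"
      by (metis One_nat_def not0_implies_Suc)
    then show ?case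
    proof cases
      case 3
      with less len have eq: "vs ! j = ws ! j" "vs ! Suc j = ws ! Suc j" by auto
      have "{ws ! Suc j, ws ! i} \<in> cycle_edges vs"
        unfolding C using 3 less.prems len by (auto simp: cycle_edges_def intro!: exI[of _ "Suc j"])
      then obtain m where m: "m < length vs"
        and "{ws ! Suc j, ws ! i} = {vs ! m, vs ! (Suc m mod length vs)}"
        by (auto simp: cycle_edges_def)
      then have "vs ! Suc j = vs ! m \<and> ws ! i = vs ! (Suc m mod length vs) \<or>
          vs ! Suc j = vs ! (Suc m mod length vs) \<and> ws ! i = vs ! m"
        using eq by (auto simp: doubleton_eq_iff)
      then show ?thesis
      proof
        assume "vs ! Suc j = vs ! m \<and> ws ! i = vs ! (Suc m mod length vs)"
        moreover from this have "m = Suc j"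
          using d m 3 less.prems by (simp add: nth_eq_iff_index_eq)
        ultimately show ?thesis using 3 less.prems by simp
      next
        \<comment> \<open>Here the edge is traversed backwards, so \<open>ws\<close> would return to
          its vertex at position \<open>j\<close>, against distinctness.\<close>
        assume *: "vs ! Suc j = vs ! (Suc m mod length vs) \<and> ws ! i = vs ! m"
        have "Suc m mod length vs < length vs"
          by (rule mod_less_divisor) (use m in linarith)
        moreover have "Suc j < length vs" using 3 less.prems by simp
        ultimately have "Suc m mod length vs = Suc j"
          using * d(1) nth_eq_iff_index_eq by fastforce
        then have "m = j" using m by (auto simp: mod_Suc split: if_splits)
        then have "ws ! i = ws ! j" using * eq by simp
        then show ?thesis using d 3 less.prems len by (simp add: nth_eq_iff_index_eq)
      qed
    qed (use st in auto)
  qed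
  then show "\<And>i. i < length vs \<Longrightarrow> vs ! i = ws ! i" .
qed

lemma cycle_start_at_dart:
  assumes "{x, y} \<in> cycle_edges vs" "2 \<le> length vs"
  obtains ws where "length ws = length vs" "set ws = set vs" "distinct ws = distinct vs"
    "cycle_edges ws = cycle_edges vs" "ws ! 0 = x" "ws ! 1 = y"
proof -
  from assms obtain i where i: "i < length vs"
    and "{x, y} = {vs ! i, vs ! (Suc i mod length vs)}"
    by (auto simp: cycle_edges_def)
  then consider "x = vs ! i" "y = vs ! (Suc i mod length vs)" | "y = vs ! i" "x = vs ! (Suc i mod length vs)"
    by (auto simp: doubleton_eq_iff)
  then show thesis
  proof cases
    case 1
    then show ?thesis
      using i assms(2) nth_rotate[of 0 vs i, OF length_pos_if_in_set[OF nth_mem[OF i]]] nth_rotate[of 1 vs i]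
      by (intro that[of "rotate i vs"]) (simp_all add: cycle_edges_rotate)
  next
    case 2
    \<comment> \<open>Rotation by \<open>i + 2\<close> moves the edge to the last two positions;
      reversal then brings it to the front, with \<open>x\<close> first.\<close>
    let ?n = "length vs" and ?ws = "rev (rotate (Suc (Suc i)) vs)"
    have n: "2 \<le> ?n" by fact
    have "?ws ! 0 = rotate (Suc (Suc i)) vs ! (?n - 1)"
      using n by (subst rev_nth) auto
    moreover have "(Suc (Suc i) + (?n - 1)) mod ?n = Suc i mod ?n"
      using n by (metis add_Suc_shift le_add_diff_inverse mod_add_self2 le_trans one_le_numeral plus_1_eq_Suc)
    ultimately have "?ws ! 0 = x"
      using n 2 by (simp add: nth_rotate del: rotate_Suc)
    moreover have "?ws ! 1 = y"
    proof -
      have "(Suc (Suc i) + (?n - 2)) mod ?n = i"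
        using n i by (metis add_2_eq_Suc add.assoc add.commute le_add_diff_inverse mod_add_self2 mod_less)
      moreover have "?ws ! 1 = rotate (Suc (Suc i)) vs ! (?n - 2)"
        using n by (subst rev_nth) (auto simp: numeral_2_eq_2)
      ultimately show ?thesis
        using n 2 by (simp add: nth_rotate del: rotate_Suc)
    qed
    ultimately show ?thesis
      by (intro that[of ?ws]) (simp_all add: cycle_edges_rev cycle_edges_rotate del: rotate_Suc)
  qed
qed

definition ordered_cycles :: "'a set \<Rightarrow> 'a set set \<Rightarrow> nat \<Rightarrow> 'a list set" where
  "ordered_cycles V E k = {vs. length vs = k \<and> distinct vs \<and> set vs \<subseteq> V \<and> cycle_edges vs \<subseteq> E}"

text \<open>The orderings of one cycle correspond to its darts, namely to the first two entries of
  the list, and \<open>k\<close> edges have \<open>2 * k\<close> darts.\<close>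

lemma card_ordered_cycles:
  assumes "finite V" "3 \<le> k"
  shows "card (ordered_cycles V E k) = 2 * k * cycle_count k V E"
proof -
  have "finite (ordered_cycles V E k)"
    by (rule finite_subset[OF _ finite_lists_length_eq[OF assms(1), of k]])
      (auto simp: ordered_cycles_def)
  moreover have "card {ws \<in> ordered_cycles V E k. cycle_edges ws = cycle_edges vs} = 2 * k"
    (is "card ?F = _") if vs: "vs \<in> ordered_cycles V E k" for vs
  proof -
    let ?D = "{(x, y). {x, y} \<in> cycle_edges vs}"
    have vs': "length vs = k" "distinct vs" "set vs \<subseteq> V" "cycle_edges vs \<subseteq> E"
      using vs by (simp_all add: ordered_cycles_def)
    have inj: "inj_on (\<lambda>ws. (ws ! 0, ws ! 1)) ?F"
      using assms(2) by (auto simp: inj_on_def ordered_cycles_def intro!: cycle_determined)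
    have img: "(\<lambda>ws. (ws ! 0, ws ! 1)) ` ?F = ?D"
    proof (intro equalityI subsetI)
      fix d assume "d \<in> (\<lambda>ws. (ws ! 0, ws ! 1)) ` ?F"
      then obtain ws where ws: "ws \<in> ?F" "d = (ws ! 0, ws ! 1)" by auto
      then have "{ws ! 0, ws ! 1} \<in> cycle_edges ws"
        using assms(2) by (auto simp: cycle_edges_def ordered_cycles_def intro!: exI[of _ 0])
      with ws show "d \<in> ?D" by auto
    next
      fix d assume "d \<in> ?D"
      then obtain x y where d: "d = (x, y)" and xy: "{x, y} \<in> cycle_edges vs" by auto
      have "2 \<le> length vs" using assms(2) vs' by simp
      with xy obtain ws where "length ws = length vs" "set ws = set vs" "distinct ws = distinct vs"
          "cycle_edges ws = cycle_edges vs" "ws ! 0 = x" "ws ! 1 = y"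
        by (rule cycle_start_at_dart)
      with vs' have "ws \<in> ?F" "d = (ws ! 0, ws ! 1)"
        using d by (simp_all add: ordered_cycles_def)
      then show "d \<in> (\<lambda>ws. (ws ! 0, ws ! 1)) ` ?F" by blast
    qed
    have "card ?F = card ?D" by (simp only: img[symmetric] card_image[OF inj])
    also have "\<dots> = 2 * k"
    proof -
      have "card (cycle_edges vs) = k"
        using vs' assms(2) card_cycle_edges by auto
      then show ?thesis
        using card_darts[of "cycle_edges vs"] card_in_cycle_edges[of vs] vs' assms(2)
        by (metis card.infinite not_numeral_le_zero)
    qed
    finally show ?thesis .
  qed
  ultimately have "card (ordered_cycles V E k) = 2 * k * card (cycle_edges ` ordered_cycles V E k)"
    by (rule card_eq_mult_card_image)
  moreover have "cycle_edges ` ordered_cycles V E k = cycles_of_length V E k"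
    using assms(2) by (auto simp: ordered_cycles_def cycles_of_length_def)
  ultimately show ?thesis by (simp add: cycle_count_def)
qed

text \<open>Counting asks for maps from the induced subgraph to the pattern, whereas the reverse
  direction is convenient in proofs, since the pattern has explicit vertices.\<close>

lemma graph_iso_sym:
  assumes "graph_iso V E W F"
  shows "graph_iso W F V E"
proof -
  from assms obtain f where f: "bij_betw f V W"
    and edge: "\<And>u v. u \<in> V \<Longrightarrow> v \<in> V \<Longrightarrow> {u, v} \<in> E \<longleftrightarrow> {f u, f v} \<in> F"
    by (auto simp: graph_iso_def)
  have "{x, y} \<in> F \<longleftrightarrow> {inv_into V f x, inv_into V f y} \<in> E" if "x \<in> W" "y \<in> W" for x y
    using edge[of "inv_into V f x" "inv_into V f y"] that f
    by (simp add: bij_betw_inv_into_right bij_betwE[OF bij_betw_inv_into])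
  then show ?thesis
    using bij_betw_inv_into[OF f] by (auto simp: graph_iso_def)
qed

section \<open>Adjacency, cycles and distance three in a cactus\<close>

locale cactus_graph =
  fixes V :: "'a set" and E :: "'a set set"
  assumes simple: "simple_graph V E" and cactus: "cactus V E"
begin

definition adj :: "'a \<Rightarrow> 'a \<Rightarrow> bool" where
  "adj u v \<longleftrightarrow> {u, v} \<in> E"

lemma finite_V: "finite V"
  using simple by (simp add: simple_graph_def)

lemma finite_E: "finite E"
  using simple by (meson Pow_iff finite_Pow_iff finite_subset simple_graph_def subsetI)

lemma adj_sym: "adj u v \<longleftrightarrow> adj v u"
  by (simp add: adj_def insert_commute)

lemma adj_neq: "adj u v \<Longrightarrow> u \<noteq> v"
  using simple by (force simp: adj_def simple_graph_def)

lemma adj_irrefl [simp]: "\<not> adj u u"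
  using adj_neq by blast

lemma adj_in_V: "adj u v \<Longrightarrow> u \<in> V \<and> v \<in> V"
  using simple by (force simp: adj_def simple_graph_def)

definition is_cycle :: "'a list \<Rightarrow> bool" where
  "is_cycle vs \<longleftrightarrow> 3 \<le> length vs \<and> vs \<in> ordered_cycles V E (length vs)"

text \<open>These lengths are the ones that occur below. Membership of the vertices in
  \<open>V\<close> is absorbed by adjacency.\<close>

lemma is_cycle_simps:
  "is_cycle [a, b, c] \<longleftrightarrow> distinct [a, b, c] \<and> adj a b \<and> adj b c \<and> adj c a"
  "is_cycle [a, b, c, d] \<longleftrightarrow> distinct [a, b, c, d] \<and> adj a b \<and> adj b c \<and> adj c d \<and> adj d a"
  "is_cycle [a, b, c, d, e] \<longleftrightarrow>
    distinct [a, b, c, d, e] \<and> adj a b \<and> adj b c \<and> adj c d \<and> adj d e \<and> adj e a"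
  "is_cycle [a, b, c, d, e, f] \<longleftrightarrow>
    distinct [a, b, c, d, e, f] \<and> adj a b \<and> adj b c \<and> adj c d \<and> adj d e \<and> adj e f \<and> adj f a"
  by (auto simp: is_cycle_def ordered_cycles_def cycle_edges_zip adj_def[symmetric] dest: adj_in_V)

text \<open>The only place where the condition on shared edges enters.\<close>

lemma cycle_unique:
  assumes "is_cycle (x # y # xs)" "is_cycle (x # y # ys)"
  shows "xs = ys"
proof -
  let ?vs = "x # y # xs" and ?ws = "x # y # ys"
  have "{x, y} \<in> cycle_edges ?vs" "{x, y} \<in> cycle_edges ?ws"
    by (auto simp: cycle_edges_zip)
  moreover have "cycle_edges ?vs \<in> cycles V E" "cycle_edges ?ws \<in> cycles V E"
    using assms unfolding is_cycle_def cycles_def cycles_of_length_def ordered_cycles_def by blast+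
  moreover have "{x, y} \<in> E"
    using assms(1) \<open>{x, y} \<in> cycle_edges ?vs\<close> by (auto simp: is_cycle_def ordered_cycles_def)
  ultimately have "cycle_edges ?vs = cycle_edges ?ws"
    using cactus unfolding cactus_def by blast
  then have "?vs = ?ws"
    using assms by (intro cycle_determined) (auto simp: is_cycle_def ordered_cycles_def)
  then show ?thesis by simp
qed

text \<open>For vertices of the graph this is distance at least 3, expressed by adjacency
  alone.\<close>

definition far :: "'a \<Rightarrow> 'a \<Rightarrow> bool" where
  "far u v \<longleftrightarrow> u \<noteq> v \<and> \<not> adj u v \<and> (\<forall>w. \<not> (adj u w \<and> adj w v))"

text \<open>The condition \<open>far a b\<close> already forces the four vertices to be
  distinct.\<close>

definition geodesics :: "'a list set" where
  "geodesics = {[a, u, v, b] | a u v b. adj a u \<and> adj u v \<and> adj v b \<and> far a b}"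

lemma path_between_successively:
  "path_between V E u p v \<longleftrightarrow>
    p \<noteq> [] \<and> distinct p \<and> set p \<subseteq> V \<and> hd p = u \<and> last p = v \<and> successively adj p"
  by (simp add: path_between_def successively_conv_nth adj_def)

lemma graph_dist_3_iff:
  assumes "u \<in> V" "v \<in> V"
  shows "graph_dist V E u v = 3 \<longleftrightarrow> (\<exists>x y. [u, x, y, v] \<in> geodesics)"
proof -
  define P where "P n \<longleftrightarrow> (\<exists>p. path_between V E u p v \<and> length p = Suc n)" for n
  \<comment> \<open>Connectedness supplies a path, so the minimum defining \<open>graph_dist\<close>
    is attained.\<close>
  have "\<exists>n. P n"
  proof -
    from cactus assms obtain p where p: "path_between V E u p v"
      unfolding cactus_def connected_graph_def by blast
    then have "length p = Suc (length p - 1)"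
      by (cases p) (auto simp: path_between_def)
    with p show ?thesis unfolding P_def by blast
  qed
  then have "P (graph_dist V E u v)" "\<And>m. m < graph_dist V E u v \<Longrightarrow> \<not> P m"
    unfolding graph_dist_def P_def[symmetric] by (auto intro: LeastI_ex dest: not_less_Least)
  then have "graph_dist V E u v = 3 \<longleftrightarrow> P 3 \<and> (\<forall>m<3. \<not> P m)"
    by (metis linorder_neqE_nat)
  also have "\<dots> \<longleftrightarrow> P 3 \<and> \<not> P 0 \<and> \<not> P 1 \<and> \<not> P 2"
    by (auto simp: numeral_3_eq_3 numeral_2_eq_2 less_Suc_eq)
  also have "P 0 \<longleftrightarrow> u = v"
    using assms by (auto simp: P_def path_between_successively length_Suc_conv intro!: exI[of _ "[v]"])
  also have "P 1 \<longleftrightarrow> adj u v"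
    using assms adj_neq
    by (auto simp: P_def path_between_successively length_Suc_conv intro!: exI[of _ "[u, v]"])
  \<comment> \<open>The vertices of a path are distinct; without \<open>u \<noteq> v\<close> a walk
    to a neighbour and back would satisfy the right-hand side.\<close>
  also have "P 2 \<longleftrightarrow> u \<noteq> v \<and> (\<exists>w. adj u w \<and> adj w v)"
  proof
    assume "P 2"
    then obtain p where "path_between V E u p v" "length p = Suc (Suc (Suc 0))"
      by (auto simp: P_def eval_nat_numeral)
    then show "u \<noteq> v \<and> (\<exists>w. adj u w \<and> adj w v)"
      by (auto simp: path_between_successively length_Suc_conv)
  next
    assume "u \<noteq> v \<and> (\<exists>w. adj u w \<and> adj w v)"
    then obtain w where w: "u \<noteq> v" "adj u w" "adj w v" by auto
    then have "path_between V E u [u, w, v] v"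
      using adj_in_V adj_neq by (auto simp: path_between_successively)
    then show "P 2" unfolding P_def by (intro exI[of _ "[u, w, v]"]) simp
  qed
  also have "(P 3 \<and> \<not> u = v \<and> \<not> adj u v \<and> \<not> (u \<noteq> v \<and> (\<exists>w. adj u w \<and> adj w v))) \<longleftrightarrow>
      (\<exists>x y. [u, x, y, v] \<in> geodesics)"
  proof
    assume *: "P 3 \<and> \<not> u = v \<and> \<not> adj u v \<and> \<not> (u \<noteq> v \<and> (\<exists>w. adj u w \<and> adj w v))"
    then obtain p where "path_between V E u p v" "length p = Suc (Suc (Suc (Suc 0)))"
      by (auto simp: P_def eval_nat_numeral)
    then obtain x y where "adj u x" "adj x y" "adj y v"
      by (auto simp: path_between_successively length_Suc_conv)
    then show "\<exists>x y. [u, x, y, v] \<in> geodesics"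
      using * unfolding geodesics_def far_def by blast
  next
    assume "\<exists>x y. [u, x, y, v] \<in> geodesics"
    then obtain x y where xy: "adj u x" "adj x y" "adj y v" "far u v"
      by (auto simp: geodesics_def)
    then have "u \<noteq> x" "u \<noteq> y" "u \<noteq> v" "x \<noteq> y" "x \<noteq> v" "y \<noteq> v"
      using adj_neq by (auto simp: far_def)
    with xy have "path_between V E u [u, x, y, v] v"
      using adj_in_V[OF xy(1)] adj_in_V[OF xy(3)] by (auto simp: path_between_successively)
    then have "P 3" unfolding P_def by (intro exI[of _ "[u, x, y, v]"]) simp
    then show "P 3 \<and> \<not> u = v \<and> \<not> adj u v \<and> \<not> (u \<noteq> v \<and> (\<exists>w. adj u w \<and> adj w v))"
      using xy by (auto simp: far_def)
  qed
  finally show ?thesis by simp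
qed

subsection \<open>Trails with three edges\<close>

text \<open>Only consecutive edges must differ. The case \<open>a = b\<close> stays in, so that the
  ends can be chosen independently of each other.\<close>

definition trails :: "'a list set" where
  "trails = {[a, u, v, b] | a u v b. adj a u \<and> adj u v \<and> adj v b \<and> a \<noteq> v \<and> u \<noteq> b}"

text \<open>The tail \<open>a\<close> hangs at \<open>u\<close>, and the list runs along the tail
  and then around the triangle in either direction.\<close>

definition tailed_triangles :: "'a list set" where
  "tailed_triangles = {[a, u, v, b] | a u v b. adj a u \<and> a \<noteq> v \<and> a \<noteq> b \<and> is_cycle [u, v, b]}"

text \<open>The first four entries form a geodesic; the fourth vertex \<open>w\<close> of the square
  is kept so that the list carries the whole vertex set.\<close>

definition tailed_squares :: "'a list set" where
  "tailed_squares = {[a, u, v, b, w] | a u v b w. adj a u \<and> a \<notin> {v, b, w} \<and> is_cycle [u, v, b, w]}"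

lemma finite_lists:
  "finite trails" "finite geodesics" "finite tailed_triangles" "finite tailed_squares"
  "finite (ordered_cycles V E k)"
proof -
  have *: "finite A" if "\<And>xs. xs \<in> A \<Longrightarrow> set xs \<subseteq> V \<and> length xs = n" for A n
    using finite_lists_length_eq[OF finite_V, of n] by (rule finite_subset[rotated]) (use that in auto)
  show "finite trails" "finite geodesics" "finite tailed_triangles"
    by (rule *[of _ 4]; auto simp: trails_def geodesics_def tailed_triangles_def is_cycle_simps dest: adj_in_V)+
  show "finite tailed_squares"
    by (rule *[of _ 5]; auto simp: tailed_squares_def is_cycle_simps dest: adj_in_V)
  show "finite (ordered_cycles V E k)"
    by (rule *[of _ k]; auto simp: ordered_cycles_def)
qed

text \<open>For a middle dart from \<open>u\<close> to \<open>v\<close>, the end \<open>a\<close> is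
  any neighbour of \<open>u\<close> except \<open>v\<close>, and \<open>b\<close> any neighbour of
  \<open>v\<close> except \<open>u\<close>. This gives the product of the reduced degrees, and each
  edge is the middle in two directions.\<close>

lemma card_trails: "int (card trails) = 2 * (\<Sum>e\<in>E. \<Prod>u\<in>e. int (degree E u) - 1)"
proof -
  define N where "N u = {v. adj u v}" for u
  define D where "D = {(u, v). {u, v} \<in> E}"
  define X where "X = (\<lambda>(u, v). (N u - {v}) \<times> (N v - {u}))"
  have finN: "finite (N u)" for u
    using finite_V by (rule finite_subset[rotated]) (auto simp: N_def dest: adj_in_V)
  have finD: "finite D"
    by (rule finite_subset[OF _ finite_cartesian_product[OF finite_V finite_V]])
      (auto simp: D_def adj_def[symmetric] dest: adj_in_V)
  have deg: "int (card (N u - {v})) = int (degree E u) - 1" if "adj u v" for u v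
  proof -
    have "card (N u) = Suc (card (N u - {v}))"
      using that finN by (intro card.remove) (auto simp: N_def)
    moreover have "degree E u = card (N u)" by (simp add: degree_def N_def adj_def)
    ultimately show ?thesis by simp
  qed
  let ?f = "\<lambda>((u, v), (a, b)). [a, u, v, b]"
  have "inj_on ?f (Sigma D X)" by (auto simp: inj_on_def)
  moreover have "?f ` Sigma D X = trails"
    by (auto simp: X_def D_def N_def trails_def adj_def[symmetric] image_def Bex_def adj_sym)
  ultimately have "card trails = card (Sigma D X)" by (metis card_image)
  also have "\<dots> = (\<Sum>d\<in>D. card (X d))"
    using finD finN by (intro card_SigmaI) (auto simp: X_def)
  finally have "int (card trails) = (\<Sum>d\<in>D. int (card (X d)))" by simp
  also have "\<dots> = (\<Sum>(u, v)\<in>D. \<Prod>x\<in>{u, v}. int (degree E x) - 1)"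
  proof (rule sum.cong[OF refl], clarify)
    fix u v assume "(u, v) \<in> D"
    then have "adj u v" "adj v u" "u \<noteq> v"
      using adj_neq adj_sym by (auto simp: D_def adj_def[symmetric])
    then show "int (card (X (u, v))) = (\<Prod>x\<in>{u, v}. int (degree E x) - 1)"
      by (simp add: X_def card_cartesian_product deg)
  qed
  also have "\<dots> = 2 * (\<Sum>e\<in>E. \<Prod>x\<in>e. int (degree E x) - 1)"
    unfolding D_def using simple finite_E by (intro sum_darts) (auto simp: simple_graph_def)
  finally show ?thesis .
qed

text \<open>The pairs of ends of geodesics are the ordered pairs at distance 3. Reversal makes this
  relation symmetric, so each unordered pair occurs twice.\<close>

lemma double_wiener: "2 * wiener_polarity V E = card ((\<lambda>xs. (hd xs, last xs)) ` geodesics)"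
proof -
  define C where "C = {{u, v} | u v. u \<in> V \<and> v \<in> V \<and> u \<noteq> v \<and> graph_dist V E u v = 3}"
  have sym: "[v, y, x, u] \<in> geodesics" if "[u, x, y, v] \<in> geodesics" for u v x y
    using that by (auto simp: geodesics_def far_def adj_sym)
  have neq: "u \<noteq> v \<and> u \<in> V \<and> v \<in> V" if "[u, x, y, v] \<in> geodesics" for u v x y
    using that by (auto simp: geodesics_def far_def dest: adj_in_V)
  have C: "{u, v} \<in> C \<longleftrightarrow> (\<exists>x y. [u, x, y, v] \<in> geodesics)" for u v
  proof
    assume "{u, v} \<in> C"
    then obtain u' v' where "{u, v} = {u', v'}" "u' \<in> V" "v' \<in> V" "graph_dist V E u' v' = 3"
      by (auto simp: C_def)
    then show "\<exists>x y. [u, x, y, v] \<in> geodesics"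
      using sym unfolding graph_dist_3_iff[OF \<open>u' \<in> V\<close> \<open>v' \<in> V\<close>]
      by (metis doubleton_eq_iff)
  next
    assume "\<exists>x y. [u, x, y, v] \<in> geodesics"
    then show "{u, v} \<in> C"
      using neq graph_dist_3_iff unfolding C_def by blast
  qed
  have "finite C"
    by (rule finite_subset[of _ "Pow V"]) (auto simp: C_def finite_V)
  moreover have "card e = 2" if "e \<in> C" for e
    using that by (auto simp: C_def)
  ultimately have "2 * card C = card {(u, v). {u, v} \<in> C}"
    by (simp add: card_darts)
  also have "{(u, v). {u, v} \<in> C} = (\<lambda>xs. (hd xs, last xs)) ` geodesics"
    unfolding C by (force simp: geodesics_def)
  finally show ?thesis by (simp add: wiener_polarity_def C_def)
qed

definition closed_trails :: "'a list set" where
  "closed_trails = {[a, u, v, a] | a u v. is_cycle [a, u, v]}"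

lemma card_closed_trails: "card closed_trails = card (ordered_cycles V E 3)"
proof -
  have "ordered_cycles V E 3 = {[a, u, v] | a u v. is_cycle [a, u, v]}"
    by (auto simp: is_cycle_def ordered_cycles_def length_Suc_conv eval_nat_numeral)
  then have "ordered_cycles V E 3 = butlast ` closed_trails"
    by (force simp: closed_trails_def)
  moreover have "inj_on butlast closed_trails"
    by (auto simp: inj_on_def closed_trails_def)
  ultimately show ?thesis by (simp add: card_image)
qed

lemma ordered_cycles_4: "ordered_cycles V E 4 = {[a, u, v, b] | a u v b. is_cycle [a, u, v, b]}"
  by (auto simp: is_cycle_def ordered_cycles_def length_Suc_conv eval_nat_numeral)

lemma ordered_cycles_5:
  "ordered_cycles V E 5 = {[a, u, v, b, w] | a u v b w. is_cycle [a, u, v, b, w]}"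
  by (auto simp: is_cycle_def ordered_cycles_def length_Suc_conv eval_nat_numeral)

lemma ordered_cycles_6:
  "ordered_cycles V E 6 = {[a, u, v, b, w, x] | a u v b w x. is_cycle [a, u, v, b, w, x]}"
  by (auto simp: is_cycle_def ordered_cycles_def length_Suc_conv eval_nat_numeral)

text \<open>The fifth vertex is recovered from the first four: two pentagons through the same trail
  share an edge.\<close>

lemma card_pentagon_trails: "card (butlast ` ordered_cycles V E 5) = card (ordered_cycles V E 5)"
  by (intro card_image) (auto simp: inj_on_def ordered_cycles_5 dest: cycle_unique)

text \<open>A chord \<open>a c\<close> would close a triangle with \<open>b\<close>, sharing the
  edge \<open>a b\<close> with the given cycle. The same argument serves pentagons and
  hexagons.\<close>

lemma square_chordless: "is_cycle [a, b, c, d] \<Longrightarrow> \<not> adj a c"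
  using cycle_unique[of a b "[c]" "[c, d]"] adj_sym by (auto simp: is_cycle_simps)

lemma pentagon_chordless: "is_cycle [a, b, c, d, e] \<Longrightarrow> \<not> adj a c"
  using cycle_unique[of a b "[c]" "[c, d, e]"] adj_sym by (auto simp: is_cycle_simps)

lemma hexagon_chordless: "is_cycle [a, b, c, d, e, f] \<Longrightarrow> \<not> adj a c"
  using cycle_unique[of a b "[c]" "[c, d, e, f]"] adj_sym by (auto simp: is_cycle_simps)

text \<open>An edge from \<open>a\<close> to \<open>b\<close> gives the 4-cycle
  \<open>u, v, b, a\<close>, and an edge from \<open>a\<close> to \<open>v\<close> the triangle
  \<open>u, v, a\<close>; both share \<open>u v\<close> with the given triangle.\<close>

lemma triangle_tail:
  assumes "adj a u" "a \<noteq> v" "a \<noteq> b" "is_cycle [u, v, b]"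
  shows "\<not> adj a b" "\<not> adj a v"
  using assms cycle_unique[of u v "[b]" "[b, a]"] cycle_unique[of u v "[b]" "[a]"] adj_sym
    adj_neq[of a u]
  by (auto simp: is_cycle_simps)

text \<open>The unions are nested to the right so that the classes can be split off one at a time
  when cardinalities are taken.\<close>

lemma trails_decompose:
  "trails = closed_trails \<union> (ordered_cycles V E 4 \<union> (butlast ` ordered_cycles V E 5 \<union>
     (tailed_triangles \<union> (rev ` tailed_triangles \<union> geodesics))))"
  (is "_ = ?R")
proof -
  note defs = trails_def closed_trails_def ordered_cycles_4 ordered_cycles_5 tailed_triangles_def
    geodesics_def
  have "trails \<subseteq> ?R"
  proof
    fix xs assume "xs \<in> trails"
    then obtain a u v b where xs: "xs = [a, u, v, b]"
      and walk: "adj a u" "adj u v" "adj v b" "a \<noteq> v" "u \<noteq> b"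
      by (auto simp: trails_def)
    have neq: "a \<noteq> u" "u \<noteq> v" "v \<noteq> b" using walk adj_neq by auto
    consider "a = b" | "a \<noteq> b" "adj a b" | "far a b" | w where "a \<noteq> b" "\<not> adj a b" "adj a w" "adj w b"
      by (auto simp: far_def)
    then show "xs \<in> ?R"
    proof cases
      case 1
      then have "xs \<in> closed_trails"
        using walk neq by (auto simp: defs xs is_cycle_simps)
      then show ?thesis by blast
    next
      case 2
      then have "xs \<in> ordered_cycles V E 4"
        using walk neq adj_sym by (auto simp: defs xs is_cycle_simps)
      then show ?thesis by blast
    next
      case 3
      then have "xs \<in> geodesics"
        using walk by (auto simp: defs xs)
      then show ?thesis by blast
    next
      case 4
      \<comment> \<open>If \<open>w = u\<close>, the triangle is \<open>u, v, b\<close> with tail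
        \<open>a\<close>; if \<open>w = v\<close>, it is \<open>v, u, a\<close> with tail
        \<open>b\<close>, read from the other end; otherwise \<open>w\<close> closes a
        pentagon.\<close>
      consider "w = u" | "w = v" | "w \<noteq> u" "w \<noteq> v" by auto
      then show ?thesis
      proof cases
        case 1
        then have "xs \<in> tailed_triangles"
          using 4 walk neq adj_sym by (auto simp: defs xs is_cycle_simps)
        then show ?thesis by blast
      next
        case 2
        then have "rev xs \<in> tailed_triangles"
          using 4 walk neq adj_sym by (auto simp: defs xs is_cycle_simps)
        then have "rev (rev xs) \<in> rev ` tailed_triangles" by (rule imageI)
        then show ?thesis by simp
      next
        case 3
        then have "[a, u, v, b, w] \<in> ordered_cycles V E 5"
          using 4 walk neq adj_sym adj_neq by (auto simp: defs is_cycle_simps)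
        then have "butlast [a, u, v, b, w] \<in> butlast ` ordered_cycles V E 5" by (rule imageI)
        then show ?thesis by (simp add: xs)
      qed
    qed
  qed
  moreover have "closed_trails \<subseteq> trails" "ordered_cycles V E 4 \<subseteq> trails"
    "butlast ` ordered_cycles V E 5 \<subseteq> trails" "tailed_triangles \<subseteq> trails"
    "rev ` tailed_triangles \<subseteq> trails" "geodesics \<subseteq> trails"
    by (auto simp: defs is_cycle_simps far_def adj_sym)
  ultimately show ?thesis by blast
qed

text \<open>The classes are told apart by their ends: \<open>a = b\<close> for closed trails,
  \<open>a\<close> adjacent to \<open>b\<close> for squares, \<open>far a b\<close> for geodesics.
  Of the other three, tailed triangles have \<open>u\<close> adjacent to \<open>b\<close>, reversed
  ones \<open>a\<close> adjacent to \<open>v\<close>, and pentagons neither.\<close>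

lemma pairwise_disjoint_trails:
  "closed_trails \<inter> (ordered_cycles V E 4 \<union> (butlast ` ordered_cycles V E 5 \<union>
     (tailed_triangles \<union> (rev ` tailed_triangles \<union> geodesics)))) = {}" (is ?P1)
  "ordered_cycles V E 4 \<inter> (butlast ` ordered_cycles V E 5 \<union>
     (tailed_triangles \<union> (rev ` tailed_triangles \<union> geodesics))) = {}" (is ?P2)
  "butlast ` ordered_cycles V E 5 \<inter> (tailed_triangles \<union> (rev ` tailed_triangles \<union> geodesics)) = {}" (is ?P3)
  "tailed_triangles \<inter> (rev ` tailed_triangles \<union> geodesics) = {}" (is ?P4)
  "rev ` tailed_triangles \<inter> geodesics = {}" (is ?P5)
proof -
  note sets = closed_trails_def ordered_cycles_4 ordered_cycles_5 tailed_triangles_def geodesics_def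
  have pentagon: "\<not> adj a b \<and> \<not> adj b a \<and> \<not> adj a v \<and> \<not> adj u b \<and> \<not> adj v a \<and> \<not> adj b u \<and>
      \<not> far a b"
    if "is_cycle [a, u, v, b, w]" for a u v b w
    using that pentagon_chordless[of a u v b w] pentagon_chordless[of u v b w a]
      pentagon_chordless[of b w a u v] adj_sym by (auto simp: is_cycle_simps far_def)
  have triangle: "adj u b \<and> adj b u \<and> \<not> adj a b \<and> \<not> adj a v \<and> \<not> adj b a \<and> \<not> adj v a \<and>
      \<not> far a b \<and> \<not> far b a"
    if "is_cycle [u, v, b]" "adj a u" "a \<noteq> v" "a \<noteq> b" for a u v b
    using that triangle_tail[of a u v b] adj_sym by (auto simp: is_cycle_simps far_def)
  have square: "adj a b \<and> adj b a" if "is_cycle [a, u, v, b]" for a u v b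
    using that adj_sym by (auto simp: is_cycle_simps)
  show ?P1
    by (auto simp: sets is_cycle_simps far_def)
  show ?P2
    by (auto simp: sets far_def dest!: pentagon triangle square)
  show ?P3
    by (auto simp: sets dest!: pentagon triangle)
  show ?P4
    by (auto simp: sets dest!: triangle)
  show ?P5
    by (auto simp: sets dest!: triangle)
qed

lemma card_trails_decompose:
  "card trails = card (ordered_cycles V E 3) + card (ordered_cycles V E 4) +
     card (ordered_cycles V E 5) + 2 * card tailed_triangles + card geodesics"
proof -
  have "finite closed_trails"
    using finite_lists(1) trails_decompose by simp
  with finite_lists pairwise_disjoint_trails show ?thesis
    unfolding trails_decompose
    by (simp add: card_Un_disjoint card_closed_trails card_pentagon_trails card_image)
qed


subsection \<open>Pairs joined by two geodesics\<close>

text \<open>A shortcut from \<open>a\<close> to \<open>b\<close> would create a chord of the square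
  or a further cycle through one of its edges at \<open>u\<close>.\<close>

lemma geodesic_square_tail:
  "is_cycle [u, v, b, w] \<Longrightarrow> adj a u \<Longrightarrow> a \<notin> {v, b, w} \<Longrightarrow> far a b"
  unfolding far_def
proof (intro conjI allI notI)
  assume c: "is_cycle [u, v, b, w]" and a: "adj a u" "a \<notin> {v, b, w}"
  \<comment> \<open>The square in the other direction, which lets \<open>cycle_unique\<close> be
    applied at the edge \<open>u w\<close>.\<close>
  then have c': "is_cycle [u, w, b, v]" and "a \<noteq> u"
    using adj_sym adj_neq[of a u] by (auto simp: is_cycle_simps)
  note ctx = this c a
  show "a = b \<Longrightarrow> False" using a by simp
  show "adj a b \<Longrightarrow> False"
    using ctx cycle_unique[of u v "[b, w]" "[b, a]"] adj_sym by (auto simp: is_cycle_simps)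
  fix x assume x: "adj a x \<and> adj x b"
  then consider "x = u" | "x = v" | "x = w" | "x \<notin> {u, v, w}" by auto
  then show False
  proof cases
    case 1
    then show ?thesis using square_chordless[OF c] x by simp
  next
    case 2
    then show ?thesis
      using ctx x cycle_unique[of u v "[b, w]" "[a]"] adj_sym by (auto simp: is_cycle_simps)
  next
    case 3
    then show ?thesis
      using ctx x cycle_unique[of u w "[b, v]" "[a]"] adj_sym by (auto simp: is_cycle_simps)
  next
    case 4
    then show ?thesis
      using ctx x cycle_unique[of u v "[b, w]" "[b, x, a]"] adj_sym adj_neq by (auto simp: is_cycle_simps)
  qed
qed

text \<open>An edge \<open>a b\<close> would close a 4-cycle with \<open>u\<close> and
  \<open>v\<close>. A common neighbour is either \<open>u\<close> or \<open>v\<close>, giving a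
  chord, or closes a pentagon; the latter includes \<open>w\<close> and \<open>x\<close>.\<close>

lemma geodesic_hexagon: "is_cycle [a, u, v, b, w, x] \<Longrightarrow> far a b"
  unfolding far_def
proof (intro conjI allI notI)
  assume c: "is_cycle [a, u, v, b, w, x]"
  show "a = b \<Longrightarrow> False" using c by (simp add: is_cycle_simps)
  show "adj a b \<Longrightarrow> False"
    using c cycle_unique[of a u "[v, b, w, x]" "[v, b]"] adj_sym by (auto simp: is_cycle_simps)
  fix y assume y: "adj a y \<and> adj y b"
  consider "y = u" | "y = v" | "y \<notin> {u, v}" by auto
  then show False
  proof cases
    case 1
    then show ?thesis
      using c y hexagon_chordless[of u v b w x a] by (auto simp: is_cycle_simps)
  next
    case 2
    then show ?thesis using c y hexagon_chordless by blast
  next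
    case 3
    then have "is_cycle [a, u, v, b, y]"
      using c y adj_sym adj_neq by (auto simp: is_cycle_simps)
    with c show ?thesis using cycle_unique by blast
  qed
qed

text \<open>Two geodesics with the same ends share the first edge, the last edge or no inner vertex.
  This gives a square with tail \<open>a\<close>, a square with tail \<open>b\<close>, or a
  hexagon.\<close>

lemma twin_geodesics_decompose:
  "{xs \<in> geodesics. \<exists>ys\<in>geodesics. ys \<noteq> xs \<and> (hd ys, last ys) = (hd xs, last xs)} =
    take 4 ` ordered_cycles V E 6 \<union> (butlast ` tailed_squares \<union> rev ` butlast ` tailed_squares)"
  (is "?T = ?R")
proof (intro equalityI subsetI)
  fix xs assume "xs \<in> ?T"
  then obtain ys where ys: "ys \<in> geodesics" "ys \<noteq> xs" "hd ys = hd xs" "last ys = last xs"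
    and "xs \<in> geodesics" by blast
  then obtain a u v b where xs: "xs = [a, u, v, b]" and 1: "adj a u" "adj u v" "adj v b" "far a b"
    unfolding geodesics_def by blast
  with ys obtain u' v' where ys': "ys = [a, u', v', b]" and 2: "adj a u'" "adj u' v'" "adj v' b"
    by (auto simp: geodesics_def)
  with ys(2) xs have ne: "u \<noteq> u' \<or> v \<noteq> v'" by auto
  note walk = 1 2
  \<comment> \<open>The crosswise equalities fail because \<open>u = v'\<close> or
    \<open>u' = v\<close> would be a common neighbour of \<open>a\<close> and
    \<open>b\<close>.\<close>
  have neq: "a \<noteq> u" "a \<noteq> u'" "u \<noteq> v" "u' \<noteq> v'" "v \<noteq> b" "v' \<noteq> b" "a \<noteq> v" "a \<noteq> v'" "u \<noteq> b" "u' \<noteq> b"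
     "u \<noteq> v'" "u' \<noteq> v" "a \<noteq> b"
    using walk adj_neq by (auto simp: far_def)
  consider "u = u'" "v \<noteq> v'" | "u \<noteq> u'" "v = v'" | "u \<noteq> u'" "v \<noteq> v'" using ne by auto
  then show "xs \<in> ?R"
  proof cases
    case 1
    then have "[a, u, v, b, v'] \<in> tailed_squares"
      using walk neq adj_sym by (auto simp: tailed_squares_def is_cycle_simps)
    then have "butlast [a, u, v, b, v'] \<in> butlast ` tailed_squares" by (rule imageI)
    then show ?thesis by (simp add: xs)
  next
    case 2
    then have "[b, v, u, a, u'] \<in> tailed_squares"
      using walk neq adj_sym by (auto simp: tailed_squares_def is_cycle_simps)
    then have "rev (butlast [b, v, u, a, u']) \<in> rev ` butlast ` tailed_squares" by (intro imageI)
    then show ?thesis by (simp add: xs)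
  next
    case 3
    then have "[a, u, v, b, v', u'] \<in> ordered_cycles V E 6"
      using walk neq adj_sym by (auto simp: ordered_cycles_6 is_cycle_simps)
    then have "take 4 [a, u, v, b, v', u'] \<in> take 4 ` ordered_cycles V E 6" by (intro imageI)
    then show ?thesis by (simp add: xs)
  qed
next
  have twin: "[a, u, v, b] \<in> ?T"
    if "far a b" "adj a u" "adj u v" "adj v b" "adj a u'" "adj u' v'" "adj v' b" "u \<noteq> u' \<or> v \<noteq> v'"
    for a u v b u' v'
  proof -
    have "[a, u, v, b] \<in> geodesics" "[a, u', v', b] \<in> geodesics"
      using that by (auto simp: geodesics_def)
    then show ?thesis using that(8) by (auto intro!: bexI[of _ "[a, u', v', b]"])
  qed
  fix xs assume "xs \<in> ?R"
  then consider "xs \<in> take 4 ` ordered_cycles V E 6" | "xs \<in> butlast ` tailed_squares"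
    | "xs \<in> rev ` butlast ` tailed_squares" by blast
  then show "xs \<in> ?T"
  proof cases
    case 1
    then obtain a u v b v' u' where xs: "xs = [a, u, v, b]" and c: "is_cycle [a, u, v, b, v', u']"
      by (auto simp: ordered_cycles_6)
    show ?thesis unfolding xs
      by (rule twin[OF geodesic_hexagon[OF c], of u v u' v']) (use c adj_sym in \<open>auto simp: is_cycle_simps\<close>)
  next
    case 2
    then obtain a u v b v' where xs: "xs = [a, u, v, b]"
      and c: "is_cycle [u, v, b, v']" "adj a u" "a \<notin> {v, b, v'}"
      by (auto simp: tailed_squares_def)
    show ?thesis unfolding xs
      by (rule twin[OF geodesic_square_tail[OF c], of u v u v']) (use c adj_sym in \<open>auto simp: is_cycle_simps\<close>)
  next
    case 3
    then obtain a u v b v' where xs: "xs = [b, v, u, a]"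
      and c: "is_cycle [u, v, b, v']" "adj a u" "a \<notin> {v, b, v'}"
      by (auto simp: tailed_squares_def)
    have "far b a" using geodesic_square_tail[OF c] adj_sym by (auto simp: far_def)
    then show ?thesis unfolding xs
      by (rule twin[of b a v u v' u]) (use c adj_sym in \<open>auto simp: is_cycle_simps\<close>)
  qed
qed

text \<open>A geodesic in two of the classes would have its middle edge on two different
  cycles.\<close>

lemma disjoint_twin_geodesics:
  "take 4 ` ordered_cycles V E 6 \<inter> (butlast ` tailed_squares \<union> rev ` butlast ` tailed_squares) = {}"
  (is ?P1)
  "butlast ` tailed_squares \<inter> rev ` butlast ` tailed_squares = {}" (is ?P2)
proof -
  have hexagon: False if "is_cycle [a, u, v, b, w, x]" "is_cycle [u, v, b, y]" for a u v b w x y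
    using that cycle_unique[of u v "[b, w, x, a]" "[b, y]"] by (auto simp: is_cycle_simps)
  have hexagon': False if "is_cycle [a, u, v, b, w, x]" "is_cycle [v, u, a, y]" for a u v b w x y
    using that cycle_unique[of v u "[a, x, w, b]" "[a, y]"] adj_sym by (auto simp: is_cycle_simps)
  have square: False if "is_cycle [u, v, b, x]" "is_cycle [v, u, a, y]" "a \<noteq> x" for a u v b x y
    using that cycle_unique[of u v "[b, x]" "[y, a]"] adj_sym by (auto simp: is_cycle_simps)
  show ?P1
    by (auto simp: ordered_cycles_6 tailed_squares_def dest: hexagon hexagon')
  show ?P2
    by (auto simp: tailed_squares_def dest: square)
qed

text \<open>The dropped vertices of the hexagon or square are recovered from the geodesic by
  uniqueness of cycles.\<close>

lemma card_twin_geodesics: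
  "card {xs \<in> geodesics. \<exists>ys\<in>geodesics. ys \<noteq> xs \<and> (hd ys, last ys) = (hd xs, last xs)} =
    card (ordered_cycles V E 6) + 2 * card tailed_squares"
proof -
  have "card (take 4 ` ordered_cycles V E 6) = card (ordered_cycles V E 6)"
    by (intro card_image) (auto simp: inj_on_def ordered_cycles_6 dest: cycle_unique)
  moreover have "card (butlast ` tailed_squares) = card tailed_squares"
    by (intro card_image) (auto simp: inj_on_def tailed_squares_def dest: cycle_unique)
  ultimately show ?thesis
    unfolding twin_geodesics_decompose
    using finite_lists disjoint_twin_geodesics by (simp add: card_Un_disjoint card_image)
qed

text \<open>If two of the three share an inner vertex, their square meets another cycle formed with
  the third. Otherwise the first geodesic lies on two hexagons, one with each of the others.\<close>

lemma no_three_geodesics: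
  assumes "[a, u, v, b] \<in> geodesics" "[a, u', v', b] \<in> geodesics" "[a, u'', v'', b] \<in> geodesics"
  shows "(u, v) = (u', v') \<or> (u, v) = (u'', v'') \<or> (u', v') = (u'', v'')"
proof (rule ccontr)
  have hexagon: "is_cycle [a, u, v, b, v', u']"
    if "[a, u, v, b] \<in> geodesics" "[a, u', v', b] \<in> geodesics" "u \<noteq> u'" "v \<noteq> v'" for a b u v u' v'
    using that adj_neq adj_sym by (auto simp: geodesics_def far_def is_cycle_simps)
  have square: "is_cycle [u, v, b, v']"
    if "[a, u, v, b] \<in> geodesics" "[a, u, v', b] \<in> geodesics" "v \<noteq> v'" for a b u v v'
    using that adj_neq adj_sym by (auto simp: geodesics_def far_def is_cycle_simps)
  have rev: "[b, v, u, a] \<in> geodesics" if "[a, u, v, b] \<in> geodesics" for a u v b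
    using that adj_sym by (auto simp: geodesics_def far_def)
  \<comment> \<open>Two geodesics through the same \<open>u\<close> are given. The third yields a
    second square if it shares \<open>u\<close>, \<open>v\<close> or \<open>v'\<close>, and a
    hexagon otherwise.\<close>
  have no_square: False
    if g: "[a, u, v, b] \<in> geodesics" "[a, u, v', b] \<in> geodesics" "[a, u'', v'', b] \<in> geodesics"
      and ne: "v \<noteq> v'" "(u'', v'') \<noteq> (u, v)" "(u'', v'') \<noteq> (u, v')" for a b u v v' u'' v''
  proof -
    have c: "is_cycle [u, v, b, v']" "is_cycle [u, v', b, v]"
      using square g ne by auto
    consider "u'' = u" | "u'' \<noteq> u" "v'' = v" | "u'' \<noteq> u" "v'' = v'" | "u'' \<noteq> u" "v'' \<noteq> v" "v'' \<noteq> v'" by auto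
    then show False
    proof cases
      case 1
      then have "is_cycle [u, v, b, v'']" using square g ne by auto
      with c(1) show ?thesis using cycle_unique 1 ne by blast
    next
      case 2
      then have "is_cycle [v, u, a, u'']" using square[OF rev rev] g by auto
      then have "is_cycle [u, v, u'', a]" using adj_sym by (auto simp: is_cycle_simps)
      with c(1) show ?thesis
        using cycle_unique[of u v "[b, v']" "[u'', a]"] g by (auto simp: geodesics_def far_def)
    next
      case 3
      then have "is_cycle [v', u, a, u'']" using square[OF rev rev] g by auto
      then have "is_cycle [u, v', u'', a]" using adj_sym by (auto simp: is_cycle_simps)
      with c(2) show ?thesis
        using cycle_unique[of u v' "[b, v]" "[u'', a]"] g by (auto simp: geodesics_def far_def)
    next
      case 4
      then have "is_cycle [a, u, v, b, v'', u'']" using hexagon g by blast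
      then have "is_cycle [u, v, b, v'', u'', a]" by (auto simp: is_cycle_simps)
      with c(1) show ?thesis using cycle_unique by blast
    qed
  qed
  assume "\<not> ?thesis"
  then have ne: "(u, v) \<noteq> (u', v')" "(u, v) \<noteq> (u'', v'')" "(u', v') \<noteq> (u'', v'')" by auto
  note g = assms
  have u: "u \<noteq> u'" "u \<noteq> u''" "u' \<noteq> u''"
    using no_square[of a u v b v' u'' v''] no_square[of a u v b v'' u' v'] no_square[of a u' v' b v'' u v] g ne
    by auto
  \<comment> \<open>The same exclusion, read from \<open>b\<close>.\<close>
  have v: "v \<noteq> v'" "v \<noteq> v''" "v' \<noteq> v''"
    using no_square[of b v u a u' v'' u''] no_square[of b v u a u'' v' u'] no_square[of b v' u' a u'' v u]
      g[THEN rev] ne by auto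
  from hexagon[OF g(1,2)] hexagon[OF g(1,3)] u v show False
    using cycle_unique[of a u "[v, b, v', u']" "[v, b, v'', u'']"] by auto
qed

text \<open>The map to the ends is at most two-to-one. Its image consists of ordered pairs, hence
  the factor 4.\<close>

lemma double_card_geodesics:
  "2 * card geodesics = 4 * wiener_polarity V E + card (ordered_cycles V E 6) + 2 * card tailed_squares"
proof -
  have "2 * card geodesics = 2 * card ((\<lambda>xs. (hd xs, last xs)) ` geodesics) +
      card {xs \<in> geodesics. \<exists>ys\<in>geodesics. ys \<noteq> xs \<and> (hd ys, last ys) = (hd xs, last xs)}"
  proof (rule card_at_most_two_to_one)
    fix xs ys zs assume "xs \<in> geodesics" "ys \<in> geodesics" "zs \<in> geodesics"
      and eq: "(hd xs, last xs) = (hd ys, last ys)" "(hd xs, last xs) = (hd zs, last zs)"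
    moreover have "\<exists>a u v b. ws = [a, u, v, b]" if "ws \<in> geodesics" for ws
      using that by (auto simp: geodesics_def)
    ultimately show "xs = ys \<or> xs = zs \<or> ys = zs"
      using no_three_geodesics by (smt (verit, best) fst_conv snd_conv last.simps list.sel(1) list.distinct(1))
  qed (rule finite_lists)
  then show ?thesis
    by (simp only: double_wiener[symmetric] card_twin_geodesics mult.assoc[symmetric])
qed

subsection \<open>Induced subgraphs\<close>

lemma induced_adj: "{x, y} \<in> induced_edges E S \<longleftrightarrow> adj x y \<and> x \<in> S \<and> y \<in> S"
  by (auto simp: induced_edges_def adj_def)

lemma tailed_triangle_adj:
  assumes "is_cycle [u, v, b]" "adj a u" "a \<noteq> v" "a \<noteq> b"
  shows "adj a u" "adj u a" "adj u v" "adj v u" "adj v b" "adj b v" "adj u b" "adj b u"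
    "\<not> adj a b" "\<not> adj b a" "\<not> adj a v" "\<not> adj v a" "distinct [a, u, v, b]"
  using assms triangle_tail[of a u v b] adj_sym adj_neq[of a u] by (auto simp: is_cycle_simps)

text \<open>The complete adjacency table: it shows that the five vertices induce no further edge,
  and it later identifies each vertex by its neighbours.\<close>

lemma tailed_square_adj:
  assumes "is_cycle [u, v, b, w]" "adj a u" "a \<notin> {v, b, w}"
  shows "adj a u" "adj u a" "adj u v" "adj v u" "adj v b" "adj b v" "adj b w" "adj w b"
    "adj w u" "adj u w" "\<not> adj a b" "\<not> adj b a" "\<not> adj a v" "\<not> adj v a" "\<not> adj a w" "\<not> adj w a"
    "\<not> adj u b" "\<not> adj b u" "\<not> adj v w" "\<not> adj w v" "distinct [a, u, v, b, w]"
proof -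
  have "far a b" using assms by (rule geodesic_square_tail)
  moreover have "\<not> adj u b" "\<not> adj v w"
    using assms(1) square_chordless[of u v b w] square_chordless[of v b w u]
    by (auto simp: is_cycle_simps)
  moreover have "\<not> adj a v" "\<not> adj a w"
    using \<open>far a b\<close> assms(1) adj_sym by (auto simp: far_def is_cycle_simps)
  moreover have "a \<noteq> u" using assms(2) adj_neq by blast
  ultimately show "adj a u" "adj u a" "adj u v" "adj v u" "adj v b" "adj b v" "adj b w" "adj w b"
    "adj w u" "adj u w" "\<not> adj a b" "\<not> adj b a" "\<not> adj a v" "\<not> adj v a" "\<not> adj a w" "\<not> adj w a"
    "\<not> adj u b" "\<not> adj b u" "\<not> adj v w" "\<not> adj w v" "distinct [a, u, v, b, w]"
    using assms by (auto simp: is_cycle_simps far_def adj_sym)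
qed

text \<open>In a cactus a triangle with a tail is automatically induced, so the listed copies cover
  exactly the counted vertex sets.\<close>

lemma set_tailed_triangles:
  "set ` tailed_triangles = {S. S \<subseteq> V \<and> graph_iso S (induced_edges E S) G1_vertices G1_edges}"
proof (intro equalityI subsetI)
  fix S assume "S \<in> set ` tailed_triangles"
  then obtain a u v b where S: "S = {a, u, v, b}" and t: "is_cycle [u, v, b]" "adj a u" "a \<noteq> v" "a \<noteq> b"
    by (auto simp: tailed_triangles_def)
  note adj = tailed_triangle_adj[OF t]
  \<comment> \<open>The list serves as the map \<open>i \<mapsto> [v, b, u, a] ! i\<close>: vertex 2
    of the pattern has degree 3 and goes to \<open>u\<close>, the leaf 3 goes to
    \<open>a\<close>.\<close>
  have "bij_betw ((!) [v, b, u, a]) G1_vertices S"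
    using adj(13) by (auto simp: bij_betw_def inj_on_def S G1_vertices_def)
  moreover have "\<forall>i\<in>G1_vertices. \<forall>j\<in>G1_vertices.
      {i, j} \<in> G1_edges \<longleftrightarrow> {[v, b, u, a] ! i, [v, b, u, a] ! j} \<in> induced_edges E S"
    using adj by (simp add: induced_adj S G1_vertices_def G1_edges_def doubleton_eq_iff)
  ultimately have "graph_iso G1_vertices G1_edges S (induced_edges E S)"
    unfolding graph_iso_def by blast
  moreover have "S \<subseteq> V" using t adj_in_V by (auto simp: S is_cycle_simps)
  ultimately show "S \<in> {S. S \<subseteq> V \<and> graph_iso S (induced_edges E S) G1_vertices G1_edges}"
    by (auto intro: graph_iso_sym)
next
  fix S assume "S \<in> {S. S \<subseteq> V \<and> graph_iso S (induced_edges E S) G1_vertices G1_edges}"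
  then have "graph_iso G1_vertices G1_edges S (induced_edges E S)"
    by (auto intro: graph_iso_sym)
  then obtain g where g: "bij_betw g G1_vertices S"
    and e: "\<And>i j. i \<in> G1_vertices \<Longrightarrow> j \<in> G1_vertices \<Longrightarrow> {i, j} \<in> G1_edges \<longleftrightarrow> {g i, g j} \<in> induced_edges E S"
    by (auto simp: graph_iso_def)
  have S: "S = {g 0, g 1, g 2, g 3}"
    using g by (auto simp: bij_betw_def G1_vertices_def)
  have "adj (g 0) (g 1)" "adj (g 1) (g 2)" "adj (g 2) (g 0)" "adj (g 2) (g 3)"
    using e[of 0 1] e[of 1 2] e[of 2 0] e[of 2 3] by (simp_all add: G1_vertices_def G1_edges_def induced_adj)
  moreover have "distinct [g 0, g 1, g 2, g 3]"
    using g by (auto simp: bij_betw_def inj_on_def G1_vertices_def)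
  ultimately have "[g 3, g 2, g 0, g 1] \<in> tailed_triangles"
    using adj_sym by (auto simp: tailed_triangles_def is_cycle_simps)
  then have "set [g 3, g 2, g 0, g 1] \<in> set ` tailed_triangles" by (rule imageI)
  moreover have "set [g 3, g 2, g 0, g 1] = S" using S by auto
  ultimately show "S \<in> set ` tailed_triangles" by simp
qed

lemma set_tailed_squares:
  "set ` tailed_squares = {S. S \<subseteq> V \<and> graph_iso S (induced_edges E S) G2_vertices G2_edges}"
proof (intro equalityI subsetI)
  fix S assume "S \<in> set ` tailed_squares"
  then obtain a u v b w where S: "S = {a, u, v, b, w}"
    and t: "is_cycle [u, v, b, w]" "adj a u" "a \<notin> {v, b, w}"
    by (auto simp: tailed_squares_def)
  note adj = tailed_square_adj[OF t]
  \<comment> \<open>In this pattern the vertex of degree 3 is 0 and the leaf is 4.\<close>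
  have "bij_betw ((!) [u, v, b, w, a]) G2_vertices S"
    using adj(21) by (auto simp: bij_betw_def inj_on_def S G2_vertices_def)
  moreover have "\<forall>i\<in>G2_vertices. \<forall>j\<in>G2_vertices.
      {i, j} \<in> G2_edges \<longleftrightarrow> {[u, v, b, w, a] ! i, [u, v, b, w, a] ! j} \<in> induced_edges E S"
    using adj by (simp add: induced_adj S G2_vertices_def G2_edges_def doubleton_eq_iff)
  ultimately have "graph_iso G2_vertices G2_edges S (induced_edges E S)"
    unfolding graph_iso_def by blast
  moreover have "S \<subseteq> V" using t adj_in_V by (auto simp: S is_cycle_simps)
  ultimately show "S \<in> {S. S \<subseteq> V \<and> graph_iso S (induced_edges E S) G2_vertices G2_edges}"
    by (auto intro: graph_iso_sym)
next
  fix S assume "S \<in> {S. S \<subseteq> V \<and> graph_iso S (induced_edges E S) G2_vertices G2_edges}"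
  then have "graph_iso G2_vertices G2_edges S (induced_edges E S)"
    by (auto intro: graph_iso_sym)
  then obtain g where g: "bij_betw g G2_vertices S"
    and e: "\<And>i j. i \<in> G2_vertices \<Longrightarrow> j \<in> G2_vertices \<Longrightarrow> {i, j} \<in> G2_edges \<longleftrightarrow> {g i, g j} \<in> induced_edges E S"
    by (auto simp: graph_iso_def)
  have S: "S = {g 0, g 1, g 2, g 3, g 4}"
    using g by (auto simp: bij_betw_def G2_vertices_def)
  have "adj (g 0) (g 1)" "adj (g 1) (g 2)" "adj (g 2) (g 3)" "adj (g 3) (g 0)" "adj (g 0) (g 4)"
    using e[of 0 1] e[of 1 2] e[of 2 3] e[of 3 0] e[of 0 4]
    by (simp_all add: G2_vertices_def G2_edges_def induced_adj)
  moreover have "distinct [g 0, g 1, g 2, g 3, g 4]"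
    using g by (auto simp: bij_betw_def inj_on_def G2_vertices_def)
  ultimately have "[g 4, g 0, g 1, g 2, g 3] \<in> tailed_squares"
    using adj_sym by (auto simp: tailed_squares_def is_cycle_simps)
  then have "set [g 4, g 0, g 1, g 2, g 3] \<in> set ` tailed_squares" by (rule imageI)
  moreover have "set [g 4, g 0, g 1, g 2, g 3] = S" using S by auto
  ultimately show "S \<in> set ` tailed_squares" by simp
qed

text \<open>The degrees inside the set fix \<open>u\<close> and \<open>a\<close>; only the exchange
  of \<open>v\<close> and \<open>b\<close> remains, giving two orderings per vertex set.\<close>

lemma card_tailed_triangles: "card tailed_triangles = 2 * b1 V E"
proof -
  have "card tailed_triangles = 2 * card (set ` tailed_triangles)"
  proof (rule card_eq_mult_card_image[OF finite_lists(3)])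
    fix xs assume "xs \<in> tailed_triangles"
    then obtain a u v b where xs: "xs = [a, u, v, b]" and t: "is_cycle [u, v, b]" "adj a u" "a \<noteq> v" "a \<noteq> b"
      by (auto simp: tailed_triangles_def)
    note adj = tailed_triangle_adj[OF t]
    have "ys = xs \<or> ys = [a, u, b, v]" if ys: "ys \<in> tailed_triangles" "set ys = set xs" for ys
    proof -
      from ys(1) obtain a' u' v' b' where ys': "ys = [a', u', v', b']"
        and t': "is_cycle [u', v', b']" "adj a' u'" "a' \<noteq> v'" "a' \<noteq> b'"
        by (auto simp: tailed_triangles_def)
      note adj' = tailed_triangle_adj[OF t']
      have mem: "a' \<in> {a, u, v, b}" "u' \<in> {a, u, v, b}" "v' \<in> {a, u, v, b}" "b' \<in> {a, u, v, b}"
        using ys(2) by (auto simp: xs ys')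
      have "u' = u"
        using mem(1-3) adj adj' by auto
      moreover have "a' = a"
        using mem adj adj' \<open>u' = u\<close> by auto
      ultimately show ?thesis
        using mem adj adj' by (auto simp: xs ys')
    qed
    moreover have "[a, u, b, v] \<in> tailed_triangles"
      using adj by (auto simp: tailed_triangles_def is_cycle_simps)
    moreover have "set [a, u, b, v] = set xs" by (auto simp: xs)
    ultimately have "{ys \<in> tailed_triangles. set ys = set xs} = {xs, [a, u, b, v]}"
      using \<open>xs \<in> tailed_triangles\<close> by blast
    moreover have "xs \<noteq> [a, u, b, v]" using adj(13) by (simp add: xs)
    ultimately show "card {ys \<in> tailed_triangles. set ys = set xs} = 2" by simp
  qed
  then show ?thesis by (simp add: set_tailed_triangles b1_def induced_count_def)
qed

text \<open>Only the exchange of \<open>v\<close> and \<open>w\<close> is free: \<open>u\<close> has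
  degree 3, \<open>b\<close> is the vertex not adjacent to \<open>u\<close>, and \<open>a\<close> is
  the neighbour of \<open>u\<close> not adjacent to \<open>b\<close>.\<close>

lemma card_tailed_squares: "card tailed_squares = 2 * b2 V E"
proof -
  have "card tailed_squares = 2 * card (set ` tailed_squares)"
  proof (rule card_eq_mult_card_image[OF finite_lists(4)])
    fix xs assume "xs \<in> tailed_squares"
    then obtain a u v b w where xs: "xs = [a, u, v, b, w]"
      and t: "is_cycle [u, v, b, w]" "adj a u" "a \<notin> {v, b, w}"
      by (auto simp: tailed_squares_def)
    note adj = tailed_square_adj[OF t]
    have "ys = xs \<or> ys = [a, u, w, b, v]" if ys: "ys \<in> tailed_squares" "set ys = set xs" for ys
    proof -
      from ys(1) obtain a' u' v' b' w' where ys': "ys = [a', u', v', b', w']"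
        and t': "is_cycle [u', v', b', w']" "adj a' u'" "a' \<notin> {v', b', w'}"
        by (auto simp: tailed_squares_def)
      note adj' = tailed_square_adj[OF t']
      have mem: "a' \<in> {a, u, v, b, w}" "u' \<in> {a, u, v, b, w}" "v' \<in> {a, u, v, b, w}"
          "b' \<in> {a, u, v, b, w}" "w' \<in> {a, u, v, b, w}"
        using ys(2) by (auto simp: xs ys')
      have u: "u' = u"
        using mem(2,1,3,5) adj adj'(1-10,21) by auto
      have b: "b' = b"
        using mem(4) adj adj' u by auto
      have a: "a' = a"
        using mem(1) adj adj' u b by auto
      show ?thesis
        using mem(3,5) adj adj' u b a by (auto simp: xs ys')
    qed
    moreover have "[a, u, w, b, v] \<in> tailed_squares"
      using adj by (auto simp: tailed_squares_def is_cycle_simps)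
    moreover have "set [a, u, w, b, v] = set xs" by (auto simp: xs)
    ultimately have "{ys \<in> tailed_squares. set ys = set xs} = {xs, [a, u, w, b, v]}"
      using \<open>xs \<in> tailed_squares\<close> by blast
    moreover have "xs \<noteq> [a, u, w, b, v]" using adj(21) by (simp add: xs)
    ultimately show "card {ys \<in> tailed_squares. set ys = set xs} = 2" by simp
  qed
  then show ?thesis by (simp add: set_tailed_squares b2_def induced_count_def)
qed

end

theorem theorem2p1:
  fixes V :: "'a set" and E :: "'a set set"
  assumes "simple_graph V E" and "cactus V E"
  shows "int (wiener_polarity V E) =
    (\<Sum>e\<in>E. \<Prod>u\<in>e. int (degree E u) - 1)
      - 3 * int (cycle_count 6 V E) - 5 * int (cycle_count 5 V E)
      - 4 * int (cycle_count 4 V E) - 3 * int (cycle_count 3 V E)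
      - 2 * int (b1 V E) - int (b2 V E)"
proof -
  interpret cactus_graph V E
    using assms by unfold_locales
  have "card (ordered_cycles V E k) = 2 * k * cycle_count k V E" if "3 \<le> k" for k
    using card_ordered_cycles[OF finite_V that] .
  \<comment> \<open>Writing \<open>W\<close> for the index and \<open>c k\<close> for the cycle
    counts, twice the edge sum is \<open>6 * c 3 + 8 * c 4 + 10 * c 5 + 4 * b1\<close> plus the
    number of geodesics, which is \<open>2 * W + 6 * c 6 + 2 * b2\<close>. Halving gives the
    formula.\<close>
  from this[of 3] this[of 4] this[of 5] this[of 6] show ?thesis
    using card_trails card_trails_decompose double_card_geodesics card_tailed_triangles card_tailed_squares
    by simp
qed

end
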